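(* There exist a homogeneous polynomial $p\in\mathbb{R}[x_1,\dots,x_6]$ of degree $3$, a vector $e\in\mathbb{R}^6$ such that $p$ is hyperbolic with respect to $e$, and vectors $v,a\in H_e(p)$ such that the Rayleigh difference $$\Delta_{v,a}(p)=D_vp\cdot D_ap-p\cdot D_vD_ap$$ is not a sum of squares of polynomials in $\mathbb{R}[x_1,\dots,x_6]$.
   Context: A homogeneous polynomial $p\in\mathbb{R}[x_1,\dots,x_n]$ is hyperbolic with respect to $e\in\mathbb{R}^n$ if $p(e)\ne0$ and for every $w\in\mathbb{R}^n$ the univariate polynomial $p(w-te)$ in $t$ has only real roots. Its hyperbolicity cone $H_e(p)$ is the set of $w\in\mathbb{R}^n$ such that all roots of $p(w-te)$ are nonnegative. $D_v$ denotes the directional derivative in direction $v$. *)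

theory Defs
  imports "HOL-Analysis.Analysis" "HOL-Library.Poly_Mapping" "HOL-Computational_Algebra.Polynomial"
begin

text \<open>
  The polynomial ring \<open>\<real>[x\<^sub>i | i \<in> 'n]\<close>, as the monoid ring of the exponent vectors
  \<open>'n \<Rightarrow>\<^sub>0 nat\<close>; ring operations and equality are those of \<^type>\<open>poly_mapping\<close>,
  so \<open>6 real_mpoly\<close> is the ring of formal real polynomials in six variables.
\<close>

type_synonym 'n real_mpoly = "('n \<Rightarrow>\<^sub>0 nat) \<Rightarrow>\<^sub>0 real"

definition homogeneous_of_degree :: "nat \<Rightarrow> 'n::finite real_mpoly \<Rightarrow> bool"
  where "homogeneous_of_degree d p \<longleftrightarrow>
    (\<forall>m \<in> Poly_Mapping.keys p. (\<Sum>i\<in>UNIV. Poly_Mapping.lookup m i) = d)"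

text \<open>Image of \<open>p\<close> when coefficients are mapped by \<open>h\<close> and \<open>x\<^sub>i\<close> is replaced by \<open>g i\<close>.\<close>

definition subst_mpoly ::
    "(real \<Rightarrow> 'b::comm_semiring_1) \<Rightarrow> ('n::finite \<Rightarrow> 'b) \<Rightarrow> 'n real_mpoly \<Rightarrow> 'b"
  where "subst_mpoly h g p =
    (\<Sum>m\<in>Poly_Mapping.keys p.
      h (Poly_Mapping.lookup p m) * (\<Prod>i\<in>UNIV. g i ^ Poly_Mapping.lookup m i))"

definition eval_mpoly :: "'n::finite real_mpoly \<Rightarrow> real ^ 'n \<Rightarrow> real"
  where "eval_mpoly p x = subst_mpoly (\<lambda>c. c) (\<lambda>i. x $ i) p"

text \<open>The univariate polynomial \<open>p(w - t e)\<close> in \<open>t\<close>.\<close>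

definition line_poly :: "'n::finite real_mpoly \<Rightarrow> real ^ 'n \<Rightarrow> real ^ 'n \<Rightarrow> real poly"
  where "line_poly p e w = subst_mpoly (\<lambda>c. [:c:]) (\<lambda>i. [:w $ i, - (e $ i):]) p"

definition complex_roots :: "real poly \<Rightarrow> complex set"
  where "complex_roots q = {z. poly (map_poly complex_of_real q) z = 0}"

definition hyperbolic :: "'n::finite real_mpoly \<Rightarrow> real ^ 'n \<Rightarrow> bool"
  where "hyperbolic p e \<longleftrightarrow>
    eval_mpoly p e \<noteq> 0 \<and> (\<forall>w. complex_roots (line_poly p e w) \<subseteq> \<real>)"

definition hyperbolicity_cone :: "real ^ 'n \<Rightarrow> 'n::finite real_mpoly \<Rightarrow> (real ^ 'n) set"
  where "hyperbolicity_cone e p =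
    {w. \<forall>z \<in> complex_roots (line_poly p e w). z \<in> \<real> \<and> 0 \<le> Re z}"

text \<open>
  Formal partial derivative. The truncated subtraction of exponents is harmless: where it
  truncates, the coefficient is \<open>0\<close>.
\<close>

definition partial_deriv :: "'n \<Rightarrow> 'n::finite real_mpoly \<Rightarrow> 'n real_mpoly"
  where "partial_deriv i p =
    (\<Sum>m\<in>Poly_Mapping.keys p.
      Poly_Mapping.single (m - Poly_Mapping.single i 1)
        (of_nat (Poly_Mapping.lookup m i) * Poly_Mapping.lookup p m))"

definition dir_deriv :: "real ^ 'n \<Rightarrow> 'n::finite real_mpoly \<Rightarrow> 'n real_mpoly"
  where "dir_deriv v p = (\<Sum>i\<in>UNIV. Poly_Mapping.single 0 (v $ i) * partial_deriv i p)"

definition rayleigh_difference ::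
    "real ^ 'n \<Rightarrow> real ^ 'n \<Rightarrow> 'n::finite real_mpoly \<Rightarrow> 'n real_mpoly"
  where "rayleigh_difference v a p =
    dir_deriv v p * dir_deriv a p - p * dir_deriv v (dir_deriv a p)"

definition sum_of_squares :: "'n::finite real_mpoly \<Rightarrow> bool"
  where "sum_of_squares f \<longleftrightarrow> (\<exists>qs. f = (\<Sum>q\<leftarrow>qs. q ^ 2))"

end

theory Submission
  imports Defs
begin

text \<open>
  In the coordinates \<open>x, y, t, a, b, c\<close> (indexed by \<open>0, \<dots>, 5\<close>) the example is
  \<open>p = t x y - x (a\<^sup>2 + c\<^sup>2) - y (a\<^sup>2 + b\<^sup>2) - 2 t (b\<^sup>2 + c\<^sup>2) + 8 a b c\<close>,
  with \<open>e\<close> the sum of the first three unit vectors and the two derivatives taken along the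
  \<open>x\<close>- and \<open>y\<close>-axes.

  The construction runs backwards. A cubic \<open>t x y - x B - y A + C\<close>, with \<open>A\<close>, \<open>B\<close>, \<open>C\<close>
  free of \<open>x\<close> and \<open>y\<close>, has Rayleigh difference \<open>\<Delta> = A B - t C\<close> along these axes, a quartic in
  the four remaining variables, and
  \<open>t p = (t x - A) (t y - B) - \<Delta>\<close>. So any quartic form \<open>\<Delta>\<close> whose restriction to \<open>t = 0\<close>
  is a product of two quadratic forms arises in this way. Quaternary quartics are the first ones of
  degree four where nonnegativity and being a sum of squares come apart, so the task is to find a
  nonnegative one which is not a sum of squares and splits on \<open>t = 0\<close>. The form
  \<open>\<Delta> = (a\<^sup>2 + b\<^sup>2) (a\<^sup>2 + c\<^sup>2) + 2 t\<^sup>2 (b\<^sup>2 + c\<^sup>2) - 8 t a b c\<close> does this; it is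
  the Choi--Lam form \<open>a\<^sup>4 + t\<^sup>2 b\<^sup>2 + b\<^sup>2 c\<^sup>2 + c\<^sup>2 t\<^sup>2 - 4 t a b c\<close> plus
  \<open>(t b - a c)\<^sup>2 + (t c - a b)\<^sup>2\<close>, two squares that vanish at the seven zeros of that form.

  Hyperbolicity follows from \<open>\<Delta> \<ge> 0\<close>. Along a line in direction \<open>e\<close> the variables
  \<open>x, y, t\<close> move together, and \<open>t x - A\<close> has, when \<open>A > 0\<close>, one root with \<open>t < 0\<close> and
  one with \<open>t > 0\<close>. At these roots \<open>t p = - \<Delta> \<le> 0\<close>, so \<open>p\<close> changes sign against its
  leading term (\<open>cubic_sign_change\<close>), and this forces all three roots to be real
  (\<open>cubic_real_rooted\<close>).

  The form \<open>\<Delta>\<close> is not a sum of squares because a quadratic form has the same trace in every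
  orthonormal basis. In the \<open>(t, a, b, c)\<close>-space, \<open>\<Delta>\<close> vanishes on three of the four
  coordinate axes and at the four pairwise orthogonal vectors \<open>(1, 1, 1, 1)\<close>,
  \<open>(1, 1, -1, -1)\<close>, \<open>(-1, 1, 1, -1)\<close>, \<open>(-1, 1, -1, 1)\<close>. A quadratic form \<open>q\<close> with
  \<open>q\<^sup>2 \<le> \<Delta>\<close> vanishes there too; computing its trace in the second basis gives \<open>0\<close>, so \<open>q\<close>
  also vanishes on the \<open>a\<close>-axis, where \<open>\<Delta>\<close> does not. Since the summands are arbitrary
  polynomials, their quadratic parts have to be extracted first
  (\<open>sum_of_squares_degree_part\<close>).
\<close>

section \<open>Formal polynomials: substitution, derivatives and degree\<close>

abbreviation exponent_sum :: "('n::finite \<Rightarrow>\<^sub>0 nat) \<Rightarrow> nat"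
  where "exponent_sum m \<equiv> \<Sum>i\<in>UNIV. Poly_Mapping.lookup m i"

definition var :: "'n \<Rightarrow> 'n::finite real_mpoly"
  where "var i = Poly_Mapping.single (Poly_Mapping.single i 1) 1"

text \<open>
  Substitution and partial derivatives are given by sums over the support, which are awkward for
  products. Both operations are additive, so this rule reduces their product rules to monomials.
\<close>

lemma mpoly_monomial_induct [case_names zero add_monomial]:
  fixes p :: "'n::finite real_mpoly"
  assumes "P 0" and "\<And>p m c. P p \<Longrightarrow> P (p + Poly_Mapping.single m c)"
  shows "P p"
proof (induction p rule: Poly_Mapping.update_induct)
  case (update p m c)
  have "Poly_Mapping.update m c p = p + Poly_Mapping.single m c"
    using update(1)
    by (intro poly_mapping_eqI) (auto simp: lookup_update lookup_add lookup_single in_keys_iff)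
  then show ?case using assms(2) update(3) by simp
qed (rule assms(1))

text \<open>
  For a ring homomorphism on coefficients, substitution is a ring homomorphism. The two instances
  below serve the evaluation at a point and the restriction to a line.
\<close>

locale coefficient_hom =
  fixes h :: "real \<Rightarrow> 'b::comm_ring_1"
  assumes h_add: "h (c + d) = h c + h d" and h_mult: "h (c * d) = h c * h d" and h_one: "h 1 = 1"
begin

lemma h_zero: "h 0 = 0"
  using h_add[of 0 0] by simp

lemma subst_add: "subst_mpoly h g (p + q) = subst_mpoly h g p + subst_mpoly h g q"
  unfolding subst_mpoly_def
  by (rule setsum_keys_plus_distrib) (simp_all add: h_zero h_add distrib_right)

lemma subst_zero: "subst_mpoly h g 0 = 0"
  by (simp add: subst_mpoly_def)

lemma subst_diff: "subst_mpoly h g (p - q) = subst_mpoly h g p - subst_mpoly h g q"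
  using subst_add[of g "p - q" q] by simp

lemma subst_single: "subst_mpoly h g (Poly_Mapping.single m c) =
    h c * (\<Prod>i\<in>UNIV. g i ^ Poly_Mapping.lookup m i)"
  by (cases "c = 0") (simp_all add: subst_mpoly_def h_zero)

lemma subst_mult: "subst_mpoly h g (p * q) = subst_mpoly h g p * subst_mpoly h g q"
proof (induction p rule: mpoly_monomial_induct)
  case zero
  show ?case by (simp add: subst_zero)
next
  case (add_monomial p m c)
  have "subst_mpoly h g (Poly_Mapping.single m c * q) =
      subst_mpoly h g (Poly_Mapping.single m c) * subst_mpoly h g q"
  proof (induction q rule: mpoly_monomial_induct)
    case (add_monomial q l d)
    then show ?case
      by (simp add: distrib_left mult_single subst_add subst_single h_mult lookup_add
          power_add prod.distrib mult_ac)
  qed (simp add: subst_zero)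
  then show ?case
    using add_monomial by (simp add: distrib_right subst_add)
qed

lemma subst_one: "subst_mpoly h g 1 = 1"
  using subst_single[of g 0 1] by (simp add: h_one)

lemma subst_numeral: "subst_mpoly h g (numeral k) = numeral k"
  by (induction k) (simp_all only: numeral.simps subst_one subst_add)

lemma subst_power: "subst_mpoly h g (p ^ k) = subst_mpoly h g p ^ k"
  by (induction k) (simp_all add: subst_one subst_mult)

lemma subst_var: "subst_mpoly h g (var i) = g i"
proof -
  have "(\<Prod>j\<in>UNIV. g j ^ Poly_Mapping.lookup (Poly_Mapping.single i 1) j)
      = (\<Prod>j\<in>UNIV. if j = i then g j else 1)"
    by (rule prod.cong) (auto simp: lookup_single)
  then show ?thesis
    by (simp add: var_def subst_single h_one)
qed

lemma subst_sum_list: "subst_mpoly h g (\<Sum>q\<leftarrow>qs. f q) = (\<Sum>q\<leftarrow>qs. subst_mpoly h g (f q))"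
  by (induction qs) (simp_all add: subst_zero subst_add)

lemmas subst_simps = subst_add subst_diff subst_mult subst_one subst_numeral
  subst_power subst_var

end

interpretation id_hom: coefficient_hom "\<lambda>c. c"
  by unfold_locales simp_all

interpretation const_hom: coefficient_hom "\<lambda>c. [:c:]"
  by unfold_locales (simp_all add: one_pCons)

lemma partial_deriv_add: "partial_deriv i (p + q) = partial_deriv i p + partial_deriv i q"
  unfolding partial_deriv_def
  by (rule setsum_keys_plus_distrib) (simp_all add: single_add distrib_left)

lemma partial_deriv_zero: "partial_deriv i 0 = 0"
  by (simp add: partial_deriv_def)

lemma partial_deriv_diff: "partial_deriv i (p - q) = partial_deriv i p - partial_deriv i q"
  using partial_deriv_add[of i "p - q" q] by simp

lemma partial_deriv_single: "partial_deriv i (Poly_Mapping.single m c) =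
    Poly_Mapping.single (m - Poly_Mapping.single i 1) (of_nat (Poly_Mapping.lookup m i) * c)"
  by (cases "c = 0") (simp_all add: partial_deriv_def)

text \<open>
  The exponents in the derivative of a monomial are truncated differences, and moving the unit
  vector from \<open>m + l\<close> to \<open>m\<close> is correct only when \<open>m\<close> involves the variable. In the other
  case the coefficient is zero.
\<close>

lemma partial_deriv_monomial_mult:
  "partial_deriv i (Poly_Mapping.single m c * Poly_Mapping.single l d) =
    partial_deriv i (Poly_Mapping.single m c) * Poly_Mapping.single l d +
    Poly_Mapping.single m c * partial_deriv i (Poly_Mapping.single l d)"
proof -
  let ?e = "Poly_Mapping.single i (1::nat)"
  \<comment> \<open>truncation does not interfere when the factor carrying the unit vector contains the variable\<close>
  have lower: "r + s - ?e = (r - ?e) + s" if "Poly_Mapping.lookup r i \<noteq> 0" for r s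
    using that by (intro poly_mapping_eqI) (auto simp: lookup_add lookup_minus lookup_single when_def)
  have l: "Poly_Mapping.single (m + l - ?e) (of_nat (Poly_Mapping.lookup m i) * (c * d)) =
      Poly_Mapping.single ((m - ?e) + l) (of_nat (Poly_Mapping.lookup m i) * (c * d))"
    using lower[of m l] by (cases "Poly_Mapping.lookup m i = 0") simp_all
  have r: "Poly_Mapping.single (m + l - ?e) (of_nat (Poly_Mapping.lookup l i) * (c * d)) =
      Poly_Mapping.single (m + (l - ?e)) (of_nat (Poly_Mapping.lookup l i) * (c * d))"
    using lower[of l m] by (cases "Poly_Mapping.lookup l i = 0") (simp_all add: add.commute)
  have "of_nat (Poly_Mapping.lookup (m + l) i) * (c * d) =
      of_nat (Poly_Mapping.lookup m i) * (c * d) + of_nat (Poly_Mapping.lookup l i) * (c * d)"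
    by (simp add: lookup_add distrib_right)
  then show ?thesis
    by (simp only: mult_single partial_deriv_single single_add l r) (simp only: mult_ac)
qed

lemma partial_deriv_mult:
  "partial_deriv i (p * q) = partial_deriv i p * q + p * partial_deriv i q"
proof (induction p rule: mpoly_monomial_induct)
  case zero
  show ?case by (simp add: partial_deriv_zero)
next
  case (add_monomial p m c)
  have "partial_deriv i (Poly_Mapping.single m c * q) =
      partial_deriv i (Poly_Mapping.single m c) * q + Poly_Mapping.single m c * partial_deriv i q"
    by (induction q rule: mpoly_monomial_induct)
      (simp_all add: partial_deriv_zero partial_deriv_add partial_deriv_monomial_mult algebra_simps)
  then show ?case
    using add_monomial by (simp add: partial_deriv_add algebra_simps)
qed

lemma partial_deriv_one: "partial_deriv i 1 = 0"
  using partial_deriv_single[of i 0 1] by simp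

lemma partial_deriv_numeral: "partial_deriv i (numeral k) = 0"
  by (induction k) (simp_all only: numeral.simps partial_deriv_one partial_deriv_add add_0)

lemma partial_deriv_var: "partial_deriv i (var j) = (if i = j then 1 else 0)"
  by (simp add: var_def partial_deriv_single lookup_single)

lemmas partial_deriv_simps = partial_deriv_add partial_deriv_diff partial_deriv_mult
  partial_deriv_zero partial_deriv_one partial_deriv_numeral partial_deriv_var power2_eq_square

lemma dir_deriv_axis: "dir_deriv (axis i 1) p = partial_deriv i p"
proof -
  have "dir_deriv (axis i 1) p = (\<Sum>j\<in>UNIV. if j = i then partial_deriv j p else 0)"
    unfolding dir_deriv_def by (rule sum.cong) (auto simp: axis_def)
  then show ?thesis by simp
qed

lemma homogeneous_add:
  "homogeneous_of_degree d p \<Longrightarrow> homogeneous_of_degree d q \<Longrightarrow> homogeneous_of_degree d (p + q)"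
  using Poly_Mapping.keys_add[of p q] by (auto simp: homogeneous_of_degree_def)

lemma homogeneous_diff:
  "homogeneous_of_degree d p \<Longrightarrow> homogeneous_of_degree d q \<Longrightarrow> homogeneous_of_degree d (p - q)"
  using keys_diff[of p q] by (auto simp: homogeneous_of_degree_def)

lemma homogeneous_mult:
  "homogeneous_of_degree d p \<Longrightarrow> homogeneous_of_degree e q \<Longrightarrow> homogeneous_of_degree (d + e) (p * q)"
  using keys_mult[of p q]
  by (fastforce simp: homogeneous_of_degree_def lookup_add sum.distrib)

lemma homogeneous_numeral: "homogeneous_of_degree 0 (numeral k)"
  unfolding homogeneous_of_degree_def
  by (simp flip: single_numeral)

lemma homogeneous_var: "homogeneous_of_degree 1 (var i)"
  by (simp add: homogeneous_of_degree_def var_def lookup_single when_def)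

section \<open>Quadratic parts of the summands of a sum of squares\<close>

text \<open>
  The value at \<open>u\<close> of the homogeneous component of degree \<open>k\<close>, read off as the coefficient of
  \<open>s\<^sup>k\<close> in \<open>q(s u)\<close>. The restriction to a line uses \<open>w - s e\<close>, hence \<open>w = 0\<close> and
  \<open>e = - u\<close>.
\<close>

definition degree_part :: "nat \<Rightarrow> 'n::finite real_mpoly \<Rightarrow> real ^ 'n \<Rightarrow> real"
  where "degree_part k q u = coeff (line_poly q (- u) 0) k"

lemma degree_part_altdef:
  "degree_part k q u =
    (\<Sum>m\<in>Poly_Mapping.keys q. if exponent_sum m = k
      then Poly_Mapping.lookup q m * (\<Prod>i\<in>UNIV. u $ i ^ Poly_Mapping.lookup m i) else 0)"
proof -
  have "(\<Prod>i\<in>I. [:0, u $ i:] ^ Poly_Mapping.lookup m i) =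
      monom (\<Prod>i\<in>I. u $ i ^ Poly_Mapping.lookup m i) (\<Sum>i\<in>I. Poly_Mapping.lookup m i)"
    if "finite I" for I and m :: "'a \<Rightarrow>\<^sub>0 nat"
    using that
  proof (induction I rule: finite_induct)
    case (insert i I)
    have "[:0, u $ i:] = monom (u $ i) 1"
      by (simp add: monom_Suc monom_0)
    with insert show ?case
      by (simp add: monom_power mult_monom)
  qed (simp add: monom_0 one_pCons)
  then show ?thesis
    by (simp add: degree_part_def line_poly_def subst_mpoly_def coeff_sum smult_monom)
qed

text \<open>
  The lowest coefficients of squares cannot cancel: if all summands have order at least \<open>j\<close>,
  the coefficient of degree \<open>2 j\<close> in the sum is the sum of the squared coefficients of degree
  \<open>j\<close>. As long as \<open>j < k\<close> it vanishes, which raises the order by one. This works from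
  below, so the degrees of the summands need not be bounded.
\<close>

lemma sum_squares_poly_middle_coeff:
  fixes ps :: "real poly list"
  assumes "(\<Sum>p\<leftarrow>ps. p ^ 2) = monom c (2 * k)"
  shows "(\<Sum>p\<leftarrow>ps. coeff p k ^ 2) = c"
proof -
  have middle: "coeff (p ^ 2) (2 * j) = coeff p j ^ 2"
    if low: "\<And>i. i < j \<Longrightarrow> coeff p i = 0" for p :: "real poly" and j
  proof -
    have "coeff (p ^ 2) (2 * j) = (\<Sum>i\<le>2 * j. coeff p i * coeff p (2 * j - i))"
      by (simp add: power2_eq_square coeff_mult)
    also have "\<dots> = (\<Sum>i\<le>2 * j. if i = j then coeff p j ^ 2 else 0)"
    proof (rule sum.cong, goal_cases)
      case (2 i)
      then show ?case
        using low[of i] low[of "2 * j - i"] by (cases i j rule: linorder_cases) (auto simp: power2_eq_square)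
    qed simp
    finally show ?thesis by simp
  qed
  have coeff_list: "coeff (\<Sum>p\<leftarrow>ps. p ^ 2) n = (\<Sum>p\<leftarrow>ps. coeff (p ^ 2) n)" for n
    by (induction ps) simp_all
  have level: "(\<Sum>p\<leftarrow>ps. coeff p j ^ 2) = coeff (monom c (2 * k)) (2 * j)"
    if "\<forall>p\<in>set ps. \<forall>i<j. coeff p i = 0" for j
    using that coeff_list[of "2 * j"] assms middle
    by (metis (mono_tags, lifting) map_eq_conv)
  have "\<forall>p\<in>set ps. coeff p j = 0" if "j < k" for j
    using that
  proof (induction j rule: less_induct)
    case (less j)
    then have "(\<Sum>p\<leftarrow>ps. coeff p j ^ 2) = 0"
      by (subst level) auto
    then show ?case
      by (subst (asm) sum_list_nonneg_eq_0_iff) auto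
  qed
  then have "\<forall>p\<in>set ps. \<forall>i<k. coeff p i = 0"
    by blast
  from level[OF this] show ?thesis by simp
qed

text \<open>
  If a form of degree \<open>2 k\<close> is a sum of squares of arbitrary polynomials, it is also the sum of
  the squares of their components of degree \<open>k\<close>. It is enough to see this on each line through the
  origin, where it is a statement about univariate polynomials.
\<close>

lemma sum_of_squares_degree_part:
  assumes "line_poly (\<Sum>q\<leftarrow>qs. q ^ 2) (- u) 0 = monom c (2 * k)"
  shows "(\<Sum>q\<leftarrow>qs. degree_part k q u ^ 2) = c"
proof -
  have "(\<Sum>p\<leftarrow>map (\<lambda>q. line_poly q (- u) 0) qs. p ^ 2) = monom c (2 * k)"
    using assms by (simp add: line_poly_def const_hom.subst_sum_list const_hom.subst_power comp_def)
  from sum_squares_poly_middle_coeff[OF this] show ?thesis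
    by (simp add: degree_part_def comp_def)
qed

lemma exponent_sum_SucE:
  fixes m :: "'n::finite \<Rightarrow>\<^sub>0 nat"
  assumes "exponent_sum m = Suc k"
  obtains i m' where "m = Poly_Mapping.single i 1 + m'" and "exponent_sum m' = k"
proof -
  obtain i where i: "Poly_Mapping.lookup m i \<noteq> 0"
    using assms by fastforce
  define m' where "m' = m - Poly_Mapping.single i 1"
  have m: "m = Poly_Mapping.single i 1 + m'"
    using i by (intro poly_mapping_eqI) (auto simp: m'_def lookup_add lookup_minus lookup_single when_def)
  have "exponent_sum m = 1 + exponent_sum m'"
    unfolding m by (simp add: lookup_add sum.distrib lookup_single when_def)
  with assms have "exponent_sum m' = k" by simp
  with m show thesis by (rule that)
qed

lemma degree_two_monomial:
  fixes m :: "'n::finite \<Rightarrow>\<^sub>0 nat"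
  assumes "exponent_sum m = 2"
  obtains i j where "\<And>u :: real ^ 'n. (\<Prod>l\<in>UNIV. u $ l ^ Poly_Mapping.lookup m l) = u $ i * u $ j"
proof -
  obtain i m' where m: "m = Poly_Mapping.single i 1 + m'" "exponent_sum m' = 1"
    using exponent_sum_SucE[of m 1] assms by (auto simp: numeral_2_eq_2)
  obtain j m'' where m': "m' = Poly_Mapping.single j 1 + m''" "exponent_sum m'' = 0"
    using exponent_sum_SucE[of m' 0] m(2) by auto
  have "m'' = 0"
    using m'(2) by (intro poly_mapping_eqI) simp
  have single: "(\<Prod>l\<in>UNIV. u $ l ^ Poly_Mapping.lookup (Poly_Mapping.single r 1) l) = u $ r"
    for u :: "real ^ 'n" and r
    using id_hom.subst_var[of "\<lambda>l. u $ l" r] by (simp add: var_def id_hom.subst_single)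
  show thesis
    by (rule that[of i j])
      (simp only: m(1) m'(1) \<open>m'' = 0\<close> lookup_add power_add prod.distrib single lookup_zero
        power_0 prod.neutral_const mult_1_right add_0_right)
qed

text \<open>
  A quadratic form is a linear function of the matrix \<open>u u\<^sup>T\<close>, so its sum over a family of
  vectors depends only on the second moments of the family. For two orthogonal bases with vectors of
  equal length these moments coincide, and the statement is the invariance of the trace.
\<close>

lemma quadratic_part_second_moments:
  fixes us vs :: "(real ^ 'n::finite) list"
  assumes "\<And>i j. (\<Sum>u\<leftarrow>us. u $ i * u $ j) = (\<Sum>v\<leftarrow>vs. v $ i * v $ j)"
  shows "(\<Sum>u\<leftarrow>us. degree_part 2 q u) = (\<Sum>v\<leftarrow>vs. degree_part 2 q v)"
proof -
  let ?M = "{m \<in> Poly_Mapping.keys q. exponent_sum m = 2}"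
  have part: "(\<Sum>u\<leftarrow>ws. degree_part 2 q u) =
      (\<Sum>m\<in>?M. Poly_Mapping.lookup q m *
        (\<Sum>u\<leftarrow>ws. \<Prod>i\<in>UNIV. u $ i ^ Poly_Mapping.lookup m i))" for ws
    by (induction ws)
      (simp_all add: degree_part_altdef sum.distrib distrib_left sum.inter_filter)
  show ?thesis
    unfolding part
  proof (rule sum.cong, goal_cases)
    case (2 m)
    then obtain i j where
      "\<And>u :: real ^ 'n. (\<Prod>l\<in>UNIV. u $ l ^ Poly_Mapping.lookup m l) = u $ i * u $ j"
      using degree_two_monomial[of m] by blast
    then show ?case using assms by simp
  qed simp
qed

section \<open>The quartic\<close>

text \<open>
  The definitions over an arbitrary ring let the same expression be read as a formal polynomial, as
  a real number and, after restriction to a line, as a univariate polynomial.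
\<close>

definition quartic :: "'a::comm_ring_1 \<Rightarrow> 'a \<Rightarrow> 'a \<Rightarrow> 'a \<Rightarrow> 'a"
  where "quartic t a b c =
    (a\<^sup>2 + b\<^sup>2) * (a\<^sup>2 + c\<^sup>2) + 2 * (t\<^sup>2 * (b\<^sup>2 + c\<^sup>2)) - 8 * (t * a * b * c)"

text \<open>
  For \<open>b c \<ge> 0\<close> the quartic is a sum of squares with nonnegative weights, one of
  which is \<open>4 b c\<close>. The symmetry that changes the signs of \<open>t\<close> and \<open>c\<close> covers the other case.
\<close>

lemma quartic_nonneg:
  fixes t a b c :: real
  shows "0 \<le> quartic t a b c"
proof -
  have nonneg: "0 \<le> quartic t a b c" if "0 \<le> b * c" for t c :: real
  proof -
    have "quartic t a b c = (a\<^sup>2 - b * c)\<^sup>2 + (a\<^sup>2 + 2 * t\<^sup>2) * (b - c)\<^sup>2 + 4 * (b * c) * (a - t)\<^sup>2"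
      unfolding quartic_def by algebra
    also have "\<dots> \<ge> 0"
      using that by (intro add_nonneg_nonneg mult_nonneg_nonneg[of "4 * (b * c)"]) simp_all
    finally show ?thesis .
  qed
  show ?thesis
  proof (cases "0 \<le> b * c")
    case False
    then have "0 \<le> quartic (- t) a b (- c)"
      by (intro nonneg) simp
    then show ?thesis by (simp add: quartic_def)
  qed (rule nonneg)
qed

definition quartic_form :: "6 real_mpoly"
  where "quartic_form = quartic (var 2) (var 3) (var 4) (var 5)"

text \<open>
  Points with \<open>x = y = 0\<close>; the quartic does not involve the first two coordinates.
\<close>

definition point :: "real \<Rightarrow> real \<Rightarrow> real \<Rightarrow> real \<Rightarrow> real ^ 6"
  where "point t a b c =
    (\<chi> i. if i = 2 then t else if i = 3 then a else if i = 4 then b else if i = 5 then c else 0)"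

lemma point_coords:
  "point t a b c $ 2 = t" "point t a b c $ 3 = a" "point t a b c $ 4 = b" "point t a b c $ 5 = c"
  by (simp_all add: point_def)

lemma quartic_form_ray:
  "line_poly quartic_form (- point t a b c) 0 = monom (quartic t a b c) (2 * 2)"
  by (simp add: quartic_form_def quartic_def line_poly_def const_hom.subst_simps point_coords)
    (simp add: monom_altdef power2_eq_square numeral_poly algebra_simps eval_nat_numeral)

text \<open>
  The family \<open>?frame\<close> is an orthogonal basis of the \<open>(t, a, b, c)\<close>-space consisting of zeros of
  the quartic. The axis vectors in \<open>?axes\<close> have length two, as the vectors of the frame do.
\<close>

lemma quartic_form_not_sum_of_squares: "\<not> sum_of_squares quartic_form"
proof
  assume "sum_of_squares quartic_form"
  then obtain qs where qs: "quartic_form = (\<Sum>q\<leftarrow>qs. q ^ 2)"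
    by (auto simp: sum_of_squares_def)
  have sq: "(\<Sum>q\<leftarrow>qs. degree_part 2 q (point t a b c) ^ 2) = quartic t a b c" for t a b c
    using quartic_form_ray[of t a b c] unfolding qs by (rule sum_of_squares_degree_part)
  have zero: "degree_part 2 q (point t a b c) = 0" if "q \<in> set qs" "quartic t a b c = 0"
    for q t a b c
  proof -
    have "\<forall>x\<in>set (map (\<lambda>q. degree_part 2 q (point t a b c) ^ 2) qs). x = 0"
      using sq[of t a b c] that(2) by (subst sum_list_nonneg_eq_0_iff[symmetric]) auto
    with that(1) show ?thesis by auto
  qed
  let ?frame = "[point 1 1 1 1, point 1 1 (-1) (-1), point (-1) 1 1 (-1), point (-1) 1 (-1) 1]"
  let ?axes = "[point 2 0 0 0, point 0 2 0 0, point 0 0 2 0, point 0 0 0 2]"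
  have "degree_part 2 q (point 0 2 0 0) = 0" if "q \<in> set qs" for q
  proof -
    have "(\<Sum>u\<leftarrow>?frame. u $ i * u $ j) = (\<Sum>v\<leftarrow>?axes. v $ i * v $ j)" for i j
      by (simp add: point_def)
    then have "(\<Sum>u\<leftarrow>?frame. degree_part 2 q u) = (\<Sum>v\<leftarrow>?axes. degree_part 2 q v)"
      by (rule quadratic_part_second_moments)
    then show ?thesis
      using that by (simp add: zero quartic_def)
  qed
  then have "(\<Sum>q\<leftarrow>qs. degree_part 2 q (point 0 2 0 0) ^ 2) = (\<Sum>q\<leftarrow>qs. 0)"
    by (intro arg_cong[of _ _ sum_list] map_cong) simp_all
  with sq[of 0 2 0 0] show False
    by (simp add: quartic_def)
qed

section \<open>The cubic\<close>

definition cubic :: "'a::comm_ring_1 \<Rightarrow> 'a \<Rightarrow> 'a \<Rightarrow> 'a \<Rightarrow> 'a \<Rightarrow> 'a \<Rightarrow> 'a"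
  where "cubic x y t a b c =
    t * x * y - x * (a * a + c * c) - y * (a * a + b * b) - 2 * (t * (b * b + c * c)) + 8 * (a * b * c)"

definition cubic_form :: "6 real_mpoly"
  where "cubic_form = cubic (var 0) (var 1) (var 2) (var 3) (var 4) (var 5)"

text \<open>
  With \<open>p = t x y - x B - y A + C\<close> this is
  \<open>(t y - B) (t x - A) - t p = A B - t C\<close>.
\<close>

lemma rayleigh_difference_cubic_form:
  "rayleigh_difference (axis 0 1) (axis 1 1) cubic_form = quartic_form"
  by (simp add: rayleigh_difference_def dir_deriv_axis cubic_form_def cubic_def quartic_form_def
      quartic_def partial_deriv_simps)
    (simp add: algebra_simps)

lemma homogeneous_cubic_form: "homogeneous_of_degree 3 cubic_form"
proof -
  have mult3: "homogeneous_of_degree 3 (p * q)"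
    if "homogeneous_of_degree 1 p" "homogeneous_of_degree 2 q" for p q :: "6 real_mpoly"
    using homogeneous_mult[OF that] by (simp add: eval_nat_numeral)
  have mult3': "homogeneous_of_degree 3 (p * q)"
    if "homogeneous_of_degree 2 p" "homogeneous_of_degree 1 q" for p q :: "6 real_mpoly"
    using homogeneous_mult[OF that] by (simp add: eval_nat_numeral)
  have mult2: "homogeneous_of_degree 2 (p * q)"
    if "homogeneous_of_degree 1 p" "homogeneous_of_degree 1 q" for p q :: "6 real_mpoly"
    using homogeneous_mult[OF that] by (simp add: eval_nat_numeral)
  have scale: "homogeneous_of_degree 3 (numeral k * q)"
    if "homogeneous_of_degree 3 q" for k and q :: "6 real_mpoly"
    using homogeneous_mult[OF homogeneous_numeral that] by simp
  show ?thesis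
    unfolding cubic_form_def cubic_def
    by (intro homogeneous_add homogeneous_diff scale)
      ((rule mult3' mult3; intro homogeneous_add mult2 homogeneous_var)+)
qed

text \<open>
  A cubic with positive leading coefficient that is \<open>\<le> 0\<close> at \<open>\<beta>\<close> has a root \<open>r \<ge> \<beta>\<close>. Splitting
  it off leaves a quadratic \<open>g\<close> with positive leading coefficient and \<open>g(\<alpha>) \<le> 0\<close>, which
  therefore has no pair of conjugate nonreal roots. Arguing with the factor \<open>g\<close> instead of counting
  sign changes lets the inequalities be weak, so multiple roots need no special treatment.
\<close>

lemma cubic_real_rooted:
  fixes f :: "real poly"
  assumes deg: "Polynomial.degree f = 3" and lead: "0 < lead_coeff f"
    and "\<alpha> < \<beta>" and f\<alpha>: "0 \<le> poly f \<alpha>" and f\<beta>: "poly f \<beta> \<le> 0"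
  shows "complex_roots f \<subseteq> \<real>"
proof
  obtain N where N: "\<And>x. N \<le> x \<Longrightarrow> lead_coeff f \<le> poly f x"
    using poly_pinfty_gt_lc[OF lead] by blast
  obtain r where r: "\<beta> \<le> r" "poly f r = 0"
  proof -
    have "\<exists>r\<ge>\<beta>. r \<le> max N \<beta> \<and> poly f r = 0"
      using f\<beta> N[of "max N \<beta>"] lead by (intro IVT') (auto intro!: continuous_intros)
    then show thesis using that by blast
  qed
  then obtain g where g: "f = [:- r, 1:] * g"
    by (metis dvdE poly_eq_0_iff_dvd)
  have "g \<noteq> 0"
    using g lead by auto
  then have "Polynomial.degree g = 2"
    using deg unfolding g by (subst (asm) degree_mult_eq) auto
  moreover have "lead_coeff f = lead_coeff g"
    unfolding g by (simp only: lead_coeff_mult) simp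
  moreover define g0 g1 g2 where "g0 = coeff g 0" "g1 = coeff g 1" "g2 = coeff g 2"
  ultimately have g012: "g = [:g0, g1, g2:]" and "0 < g2"
    using lead by (auto intro!: poly_eqI simp: coeff_pCons coeff_eq_0 numeral_2_eq_2 split: nat.split)
  have "(\<alpha> - r) * poly g \<alpha> \<ge> 0"
    using f\<alpha> unfolding g by (simp add: algebra_simps)
  then have g\<alpha>: "poly g \<alpha> \<le> 0"
    using \<open>\<alpha> < \<beta>\<close> \<open>\<beta> \<le> r\<close> by (simp add: zero_le_mult_iff)
  fix z assume "z \<in> complex_roots f"
  then have "(z - of_real r) * (of_real g0 + z * (of_real g1 + z * of_real g2)) = 0"
    unfolding g g012 complex_roots_def by (simp add: map_poly_pCons algebra_simps)
  then consider "z = of_real r" | "of_real g0 + z * (of_real g1 + z * of_real g2) = 0"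
    by auto
  then show "z \<in> \<real>"
  proof cases
    case 2
    show ?thesis
    proof (rule ccontr)
      assume "z \<notin> \<real>"
      then have im: "Im z \<noteq> 0"
        by (simp add: complex_is_Real_iff)
      have "Im z * (g1 + 2 * g2 * Re z) = 0"
        using arg_cong[OF 2, of Im] by (simp add: algebra_simps)
      with im have g1: "g1 = - 2 * g2 * Re z"
        by simp
      have "g0 + g1 * Re z + g2 * ((Re z)\<^sup>2 - (Im z)\<^sup>2) = 0"
        using arg_cong[OF 2, of Re] by (simp add: algebra_simps power2_eq_square)
      then have "g0 = g2 * ((Re z)\<^sup>2 + (Im z)\<^sup>2)"
        unfolding g1 by (simp add: algebra_simps power2_eq_square)
      \<comment> \<open>a real quadratic with roots \<open>z\<close> and \<open>cnj z\<close> is \<open>g2 * (cmod (s - z))\<^sup>2\<close> at real \<open>s\<close>\<close>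
      then have "poly g \<alpha> = g2 * ((\<alpha> - Re z)\<^sup>2 + (Im z)\<^sup>2)"
        unfolding g012 g1 by (simp add: algebra_simps power2_eq_square)
      also have "\<dots> > 0"
        using \<open>0 < g2\<close> im by (intro mult_pos_pos add_nonneg_pos) simp_all
      finally show False using g\<alpha> by simp
    qed
  qed simp
qed

definition direction :: "real ^ 6"
  where "direction = (\<chi> i. if i \<in> {0, 1, 2} then 1 else 0)"

lemma line_poly_cubic_form:
  "line_poly cubic_form direction w =
    cubic [:w $ 0, -1:] [:w $ 1, -1:] [:w $ 2, -1:] [:w $ 3:] [:w $ 4:] [:w $ 5:]"
  by (simp add: cubic_form_def cubic_def line_poly_def const_hom.subst_simps direction_def)

lemma complex_roots_uminus: "complex_roots (- f) = complex_roots f"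
proof -
  have "map_poly complex_of_real (- f) = - map_poly complex_of_real f"
    by (intro poly_eqI) (simp add: coeff_map_poly)
  then show ?thesis by (simp add: complex_roots_def)
qed

text \<open>
  The points \<open>\<alpha>\<close> and \<open>\<beta>\<close> are the roots of the quadratic \<open>(x - s) (t - s) - (a\<^sup>2 + b\<^sup>2)\<close> in
  \<open>s\<close>. It is negative at \<open>s = t\<close>, so \<open>t - s\<close> has opposite signs at them, while
  \<open>t - s\<close> times the cubic equals minus the quartic there.
\<close>

lemma cubic_sign_change:
  fixes x y t a b c :: real
  assumes "0 < a\<^sup>2 + b\<^sup>2"
  obtains \<alpha> \<beta> where "\<alpha> < \<beta>" and "cubic (x - \<alpha>) (y - \<alpha>) (t - \<alpha>) a b c \<le> 0"
    and "0 \<le> cubic (x - \<beta>) (y - \<beta>) (t - \<beta>) a b c"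
proof -
  define d where "d = sqrt ((x - t)\<^sup>2 + 4 * (a\<^sup>2 + b\<^sup>2))"
  have d2: "d\<^sup>2 = (x - t)\<^sup>2 + 4 * (a\<^sup>2 + b\<^sup>2)"
    unfolding d_def by simp
  have d: "\<bar>x - t\<bar> < d"
    unfolding d_def using assms by (intro real_less_rsqrt) simp
  let ?\<alpha> = "(x + t - d) / 2" and ?\<beta> = "(x + t + d) / 2"
  have key: "(t - s) * cubic (x - s) (y - s) (t - s) a b c \<le> 0"
    if "(x - s) * (t - s) = a\<^sup>2 + b\<^sup>2" for s
  proof -
    have "(t - s) * cubic (x - s) (y - s) (t - s) a b c =
        ((x - s) * (t - s) - (a\<^sup>2 + b\<^sup>2)) * ((y - s) * (t - s) - (a\<^sup>2 + c\<^sup>2)) - quartic (t - s) a b c"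
      unfolding cubic_def quartic_def by algebra
    then show ?thesis using that quartic_nonneg[of "t - s" a b c] by simp
  qed
  have level: "(x - s) * (t - s) = a\<^sup>2 + b\<^sup>2" if "(2 * s - x - t)\<^sup>2 = d\<^sup>2" for s
    using that unfolding d2 by (simp add: power2_eq_square algebra_simps)
  have "(t - ?\<alpha>) * cubic (x - ?\<alpha>) (y - ?\<alpha>) (t - ?\<alpha>) a b c \<le> 0"
    by (intro key level) (simp add: field_simps)
  moreover have "(t - ?\<beta>) * cubic (x - ?\<beta>) (y - ?\<beta>) (t - ?\<beta>) a b c \<le> 0"
    by (intro key level) (simp add: field_simps)
  moreover have "?\<alpha> < t" "t < ?\<beta>" "?\<alpha> < ?\<beta>"
    using d by (auto simp: abs_less_iff)
  ultimately show thesis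
    by (intro that[of ?\<alpha> ?\<beta>]) (auto simp: mult_le_0_iff)
qed

lemma cubic_swap: "cubic x y t a b c = cubic y x t a c b"
  by (simp add: cubic_def algebra_simps)

text \<open>
  If \<open>a\<^sup>2 + b\<^sup>2 = 0\<close>, the sign change comes from the other quadratic factor, by the symmetry that
  exchanges \<open>x\<close> with \<open>y\<close> and \<open>b\<close> with \<open>c\<close>. If \<open>a = b = c = 0\<close>, the cubic is a product of three
  real linear factors. The real-rootedness criterion is applied to the negated restriction, because
  \<open>p(w - s e)\<close> has leading coefficient \<open>-1\<close>.
\<close>

lemma hyperbolic_cubic_form: "hyperbolic cubic_form direction"
proof -
  have "complex_roots (line_poly cubic_form direction w) \<subseteq> \<real>" for w
  proof -
    define x y t a b c where defs: "x = w $ 0" "y = w $ 1" "t = w $ 2" "a = w $ 3" "b = w $ 4" "c = w $ 5"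
    define f where "f = - line_poly cubic_form direction w"
    have f: "f = - cubic [:x, -1:] [:y, -1:] [:t, -1:] [:a:] [:b:] [:c:]"
      by (simp add: f_def line_poly_cubic_form defs)
    have poly_f: "poly f s = - cubic (x - s) (y - s) (t - s) a b c" for s
      by (simp add: f cubic_def algebra_simps)
    have "complex_roots f \<subseteq> \<real>"
    proof (cases "a = 0 \<and> b = 0 \<and> c = 0")
      case True
      then have "f = - ([:t, -1:] * [:x, -1:] * [:y, -1:])"
        by (simp add: f cubic_def)
      then have "complex_roots f = {z. (of_real t - z) * (of_real x - z) * (of_real y - z) = 0}"
        unfolding complex_roots_uminus
        by (auto simp: complex_roots_def map_poly_pCons algebra_simps)
      then show ?thesis by auto
    next
      case False
      then consider "0 < a\<^sup>2 + b\<^sup>2" | "0 < a\<^sup>2 + c\<^sup>2"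
        by (metis sum_power2_gt_zero_iff)
      then obtain \<alpha> \<beta> where "\<alpha> < \<beta>" "0 \<le> poly f \<alpha>" "poly f \<beta> \<le> 0"
      proof cases
        case 1
        then show ?thesis
          using cubic_sign_change[of a b x y t c] that by (metis neg_0_le_iff_le neg_le_0_iff_le poly_f)
      next
        case 2
        then show ?thesis
          using cubic_sign_change[of a c y x t b] that
          by (metis neg_0_le_iff_le neg_le_0_iff_le poly_f cubic_swap)
      qed
      moreover have "Polynomial.degree f = 3" "lead_coeff f = 1"
        by (simp_all add: f cubic_def numeral_poly)
      ultimately show ?thesis
        by (intro cubic_real_rooted) simp_all
    qed
    then show ?thesis by (simp add: f_def complex_roots_uminus)
  qed
  moreover have "eval_mpoly cubic_form direction = 1"
    by (simp add: eval_mpoly_def cubic_form_def cubic_def id_hom.subst_simps direction_def)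
  ultimately show ?thesis by (simp add: hyperbolic_def)
qed

text \<open>
  For either axis vector \<open>v\<close>, \<open>p(v - s e) = s\<^sup>2 (1 - s)\<close>, so the axes lie on the boundary of the cone.
\<close>

lemma axes_in_cone:
  "axis 0 1 \<in> hyperbolicity_cone direction cubic_form"
  "axis 1 1 \<in> hyperbolicity_cone direction cubic_form"
proof -
  have roots: "complex_roots [:0, 0, 1, -1:] = {0, 1}"
    by (auto simp: complex_roots_def map_poly_pCons)
  show "axis 0 1 \<in> hyperbolicity_cone direction cubic_form"
    by (simp add: hyperbolicity_cone_def line_poly_cubic_form cubic_def axis_def roots)
  show "axis 1 1 \<in> hyperbolicity_cone direction cubic_form"
    by (simp add: hyperbolicity_cone_def line_poly_cubic_form cubic_def axis_def roots)
qed

theorem theorem2p3: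
  shows "\<exists>(p :: 6 real_mpoly) (e :: real ^ 6) (v :: real ^ 6) (a :: real ^ 6).
    homogeneous_of_degree 3 p \<and> hyperbolic p e \<and>
    v \<in> hyperbolicity_cone e p \<and> a \<in> hyperbolicity_cone e p \<and>
    \<not> sum_of_squares (rayleigh_difference v a p)"
proof (intro exI conjI)
  show "\<not> sum_of_squares (rayleigh_difference (axis 0 1) (axis 1 1) cubic_form)"
    unfolding rayleigh_difference_cubic_form by (rule quartic_form_not_sum_of_squares)
qed (rule homogeneous_cubic_form hyperbolic_cubic_form axes_in_cone)+

end
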